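(* Let $(\mathcal{X},d_{\mathcal{X}})$ be a compact metric space and $(\mathcal{Y},d_{\mathcal{Y}})$ a metric space. Let $f\colon\mathcal{X}\to\mathcal{Y}$ be continuous and of class $\rho$, where $\rho\colon[0,\infty]\to[0,\infty]$ is monotonically increasing with $\rho\geq C\,\omega(f,\cdot)$ for some constant $C>0$. Let $\mathcal{X}=\bigcup_{i=1}^M X^{(i)}$ be a partition into mutually disjoint sets, let $\hat{x}_i\in X^{(i)}$ for $i=1,\ldots,M$, and let $h>0$ be such that $\operatorname{diam}(X^{(i)})\leq h$ for $i=1,\ldots,M$. Then the piecewise constant interpolant $I_{\Xi_M}f$ satisfies $$\sup_{x\in\mathcal{X}}d_{\mathcal{Y}}\big(f(x),(I_{\Xi_M}f)(x)\big)\leq\rho(h)\,|f|_\rho.$$ For the specific choice $\rho=\omega(f,\cdot)$ one obtains $$\sup_{x\in\mathcal{X}}d_{\mathcal{Y}}\big(f(x),(I_{\Xi_M}f)(x)\big)\leq\omega(f,h).$$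
   Context: The modulus of continuity is $\omega(f,t)=\sup\{d_{\mathcal{Y}}(f(x),f(x')): x,x'\in\mathcal{X},\ d_{\mathcal{X}}(x,x')\leq t\}$ for $t\in[0,\infty]$. For monotonically increasing $\rho$, $|f|_\rho=\sup_{t>0}\rho(t)^{-1}\omega(f,t)$, and $f$ is of class $\rho$ if $|f|_\rho<\infty$. With $\Xi_M=\{(\hat{x}_i,X^{(i)})\}_{i=1}^M$, the interpolant is $I_{\Xi_M}f=\sum_{i=1}^M f(\hat{x}_i)\mathbf{1}_{X^{(i)}}$, that is, $(I_{\Xi_M}f)(x)=f(\hat{x}_i)$ for $x\in X^{(i)}$.
   Formalization: The product ρ(h)|f|_ρ is read with ∞·0 = ∞, so the first bound says nothing when ρ(h) = ∞; with ∞·0 = 0 it would fail, e.g. for ρ ≡ ∞, where |f|_ρ = 0 for every f. The quotient in |f|_ρ uses 0/0 = 0. *)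

theory Defs
  imports "HOL-Analysis.Analysis"
begin

definition modulus_of_continuity ::
    "'a::metric_space set \<Rightarrow> ('a \<Rightarrow> 'b::metric_space) \<Rightarrow> ennreal \<Rightarrow> ennreal" where
  "modulus_of_continuity X f t =
     Sup {ennreal (dist (f x) (f x')) | x x'. x \<in> X \<and> x' \<in> X \<and> ennreal (dist x x') \<le> t}"

text \<open>
  The quotient of the modulus by \<open>\<rho> t\<close> is taken in \<open>ennreal\<close>, so \<open>0/0 = 0\<close>, \<open>a/0 = \<infinity>\<close> for
  \<open>a > 0\<close>, and \<open>a/\<infinity> = 0\<close>. The value \<open>t = \<infinity>\<close> is included in the supremum.
\<close>
definition rho_seminorm ::
    "'a::metric_space set \<Rightarrow> (ennreal \<Rightarrow> ennreal) \<Rightarrow> ('a \<Rightarrow> 'b::metric_space) \<Rightarrow> ennreal" where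
  "rho_seminorm X \<rho> f = (SUP t\<in>{0<..}. inverse (\<rho> t) * modulus_of_continuity X f t)"

definition of_class ::
    "'a::metric_space set \<Rightarrow> (ennreal \<Rightarrow> ennreal) \<Rightarrow> ('a \<Rightarrow> 'b::metric_space) \<Rightarrow> bool" where
  "of_class X \<rho> f \<longleftrightarrow> rho_seminorm X \<rho> f < \<infinity>"

text \<open>
  The product on \<open>[0,\<infinity>]\<close> with the convention \<open>\<infinity> \<cdot> 0 = 0 \<cdot> \<infinity> = \<infinity>\<close>; it agrees with \<open>(*)\<close> in all other
  cases. A bound \<open>\<rho> h \<cdot> |f|\<^sub>\<rho>\<close> with \<open>\<rho> h = \<infinity>\<close> carries no information, even when
  \<open>|f|\<^sub>\<rho> = 0\<close>: for \<open>\<rho>\<close> constantly \<open>\<infinity>\<close> every \<open>f\<close> has \<open>|f|\<^sub>\<rho> = 0\<close>, and the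
  product of \<open>ennreal\<close>, where \<open>\<infinity> \<cdot> 0 = 0\<close>, would turn the bound into \<open>0\<close>. This is also the
  convention under which the quotient \<open>a/b\<close> above is the least \<open>c\<close> with \<open>a \<le> b \<cdot> c\<close>, for
  finite \<open>a\<close>.
\<close>
definition bound_times :: "ennreal \<Rightarrow> ennreal \<Rightarrow> ennreal" where
  "bound_times a b = (if a = \<infinity> \<or> b = \<infinity> then \<infinity> else a * b)"

text \<open>
  The target is only a metric space, so the sum of the values \<open>f (xhat i)\<close> against the indicators of
  the pieces \<open>P i\<close> is read pointwise: on \<open>P i\<close> the value is \<open>f (xhat i)\<close>. Outside the union of
  the pieces the value is unspecified.
\<close>
definition pc_interpolant ::
    "nat \<Rightarrow> (nat \<Rightarrow> 'a) \<Rightarrow> (nat \<Rightarrow> 'a set) \<Rightarrow> ('a \<Rightarrow> 'b) \<Rightarrow> 'a \<Rightarrow> 'b" where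
  "pc_interpolant M xhat P f x = f (xhat (THE i. i \<in> {1..M} \<and> x \<in> P i))"

end

theory Submission
  imports Defs
begin

text \<open>Every x in X shares its piece \<open>P i\<close> with the node \<open>xhat i\<close>, so
  the two are at distance at most \<open>diameter (P i)\<close>, hence at most h. The error at x is
  therefore one of the distances whose supremum is the modulus at h, which gives the specific bound.
  The bound for general \<rho> follows from it: the seminorm is a supremum of quotients of the
  modulus by \<rho>, so clearing the denominator at t = h bounds the modulus
  (\<open>modulus_le_bound_times_rho_seminorm\<close>).\<close>

lemma modulus_le_bound_times_rho_seminorm:
  fixes f :: "'a::metric_space \<Rightarrow> 'b::metric_space"
  assumes "t > 0"
  shows "modulus_of_continuity X f t \<le> bound_times (\<rho> t) (rho_seminorm X \<rho> f)"
proof -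
  define w where "w = modulus_of_continuity X f t"
  define S where "S = rho_seminorm X \<rho> f"
  have le: "inverse (\<rho> t) * w \<le> S"
    unfolding w_def S_def rho_seminorm_def using assms by (intro SUP_upper) auto
  have "w \<le> bound_times (\<rho> t) S"
  \<comment> \<open>If either factor is infinite, \<open>bound_times\<close> is infinite by
    convention; otherwise it is the ordinary product.\<close>
  proof (cases "\<rho> t = \<infinity> \<or> S = \<infinity>")
    case False
    show ?thesis
    proof (cases "\<rho> t = 0")
      case True
      \<comment> \<open>Here \<open>inverse (\<rho> t)\<close> is infinite, so a nonzero w would
        force S to be infinite.\<close>
      with le False have "w = 0"
        by (cases "w = 0") (simp_all add: ennreal_top_mult top_unique)
      then show ?thesis by simp
    next
      case nonzero: False
      \<comment> \<open>Cancellation in \<open>ennreal\<close> is legitimate because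
        \<open>\<rho> t\<close> is neither 0 nor infinite.\<close>
      have "w = \<rho> t * inverse (\<rho> t) * w"
        using False nonzero
        by (simp add: divide_ennreal_def[symmetric] ennreal_divide_self less_top)
      also have "\<dots> \<le> \<rho> t * S"
        using le by (simp add: mult.assoc mult_left_mono)
      finally show ?thesis
        using False by (simp add: bound_times_def)
    qed
  qed (simp add: bound_times_def)
  then show ?thesis by (simp add: w_def S_def)
qed

lemma pc_interpolant_eq:
  assumes "disjoint_family_on P {1..M}" and "i \<in> {1..M}" and "x \<in> P i"
  shows "pc_interpolant M xhat P f x = f (xhat i)"
proof -
  have "(THE j. j \<in> {1..M} \<and> x \<in> P j) = i"
    using assms unfolding disjoint_family_on_def by (intro the_equality) blast+
  then show ?thesis by (simp add: pc_interpolant_def)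
qed

theorem lemma6p1:
  fixes X :: "'a::metric_space set"
    and f :: "'a \<Rightarrow> 'b::metric_space"
    and M :: nat
    and P :: "nat \<Rightarrow> 'a set"
    and xhat :: "nat \<Rightarrow> 'a"
    and h :: real
  assumes "compact X"
    and "continuous_on X f"
    and "X = (\<Union>i\<in>{1..M}. P i)"
    and "disjoint_family_on P {1..M}"
    and "\<And>i. i \<in> {1..M} \<Longrightarrow> xhat i \<in> P i"
    and "h > 0"
    and "\<And>i. i \<in> {1..M} \<Longrightarrow> diameter (P i) \<le> h"
  shows "(\<forall>(\<rho> :: ennreal \<Rightarrow> ennreal) (C :: real).
            mono \<rho> \<longrightarrow> C > 0 \<longrightarrow>
            (\<forall>t. ennreal C * modulus_of_continuity X f t \<le> \<rho> t) \<longrightarrow>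
            of_class X \<rho> f \<longrightarrow>
            (SUP x\<in>X. ennreal (dist (f x) (pc_interpolant M xhat P f x)))
              \<le> bound_times (\<rho> (ennreal h)) (rho_seminorm X \<rho> f))
       \<and> (SUP x\<in>X. ennreal (dist (f x) (pc_interpolant M xhat P f x)))
            \<le> modulus_of_continuity X f (ennreal h)"
proof -
  have "(SUP x\<in>X. ennreal (dist (f x) (pc_interpolant M xhat P f x)))
      \<le> modulus_of_continuity X f (ennreal h)"
  proof (rule SUP_least)
    fix x assume "x \<in> X"
    then obtain i where i: "i \<in> {1..M}" "x \<in> P i"
      using assms(3) by blast
    have sub: "P i \<subseteq> X"
      using assms(3) i(1) by blast
    \<comment> \<open>The real-valued \<open>diameter\<close> is sure to dominate distances only on
      a bounded set; compactness of X supplies this.\<close>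
    have "bounded (P i)"
      using sub compact_imp_bounded[OF assms(1)] bounded_subset by blast
    then have "dist x (xhat i) \<le> h"
      using diameter_bounded_bound[OF _ i(2) assms(5)[OF i(1)]] assms(7)[OF i(1)] by simp
    then have "ennreal (dist (f x) (f (xhat i))) \<le> modulus_of_continuity X f (ennreal h)"
      unfolding modulus_of_continuity_def
      using \<open>x \<in> X\<close> sub assms(5)[OF i(1)] by (intro Sup_upper) (auto intro: ennreal_leI)
    then show "ennreal (dist (f x) (pc_interpolant M xhat P f x))
        \<le> modulus_of_continuity X f (ennreal h)"
      by (simp add: pc_interpolant_eq[OF assms(4) i])
  qed
  \<comment> \<open>Since h > 0, \<open>ennreal h\<close> lies in the index range of the supremum
    defining the seminorm.\<close>
  moreover have "modulus_of_continuity X f (ennreal h)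
      \<le> bound_times (\<rho> (ennreal h)) (rho_seminorm X \<rho> f)" for \<rho>
    using assms(6) by (intro modulus_le_bound_times_rho_seminorm) simp
  ultimately show ?thesis
    by (blast intro: order_trans)
qed

end
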